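(* Let $(\mathcal{F},\mathcal{G})$ be a graph iterated function system on $\mathbb{R}^M$ with edges labelled $1,\dots,N$, and let $\Sigma_{\mathrm{top}}\subseteq [N]^{\mathbb{N}}$ be its set of top addresses. Then the closure $\overline{\Sigma}_{\mathrm{top}}$ of $\Sigma_{\mathrm{top}}$ in $[N]^{\mathbb{N}}$ is a shift space over $[N]$, i.e. there is a set $B$ of finite words over $[N]$ such that $\overline{\Sigma}_{\mathrm{top}}$ is exactly the set of strings in $[N]^{\mathbb{N}}$ that contain no word of $B$.
   Context: $\mathbb{N}=\{1,2,\dots\}$ and $[N]=\{1,\dots,N\}$. The space $[N]^{\mathbb{N}}$ of right-infinite strings has the metric $d(x,y)=2^{-\min\{k:x_k\neq y_k\}}$ for $x\ne y$ (the product topology of the discrete topologies). A string contains a word if the word occurs as a block of consecutive letters. A graph iterated function system on $\mathbb{R}^M$ is a pair $(\mathcal{F},\mathcal{G})$ where $\mathcal{F}=\{f_1,\dots,f_N\}$ is a finite collection of invertible contractive maps on $\mathbb{R}^M$ and $\mathcal{G}$ is a strongly connected primitive finite directed graph with vertex set $\mathcal{V}$ and $N$ edges labelled $1,\dots,N$. The source and target vertices of the edge $i$ are $i^-$ and $i^+$. An address is a string $\sigma\in[N]^{\mathbb{N}}$ with $\sigma_k^+=\sigma_{k+1}^-$ for all $k$; $\Sigma$ is the set of addresses, $\sigma^-=\sigma_1^-$, and $\Sigma_v=\{\sigma\in\Sigma:\sigma^-=v\}$ for $v\in\mathcal{V}$. The address map $\pi:\Sigma\to\mathbb{R}^M$ is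 $\pi(\sigma)=\lim_{k\to\infty}f_{\sigma_1}\circ\cdots\circ f_{\sigma_k}(x)$, which is independent of $x\in\mathbb{R}^M$ and continuous. The attractor is $A=\pi(\Sigma)$, with components $A_v=\pi(\Sigma_v)$. Standing assumption: $A_v\cap A_{v'}=\varnothing$ whenever $v\neq v'$. $[N]^{\mathbb{N}}$ carries the lexicographic order induced by the usual order on $[N]$; every nonempty closed subset has a minimum. Define $\tau:A\to\Sigma$ by $\tau(x)=\min\pi^{-1}(x)$, and $\Sigma_{\mathrm{top}}=\tau(A)$, the set of top addresses. *)

theory Defs
  imports
    "HOL-Analysis.Analysis"
    "HOL-Library.Fun_Lexorder"
    "Graph_Theory.Digraph_Component"
begin

text \<open>
  Strings are functions on \<open>nat\<close>, so the letter written $x_k$ ($k \ge 1$) in the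
  mathematical text is \<open>x (k - 1)\<close>. The alphabet $[N]$ is \<open>{1..N}\<close>.
\<close>

definition full_shift :: "nat \<Rightarrow> (nat \<Rightarrow> nat) set" where
  "full_shift N = {x. \<forall>k. x k \<in> {1..N}}"

text \<open>Its underlying set is \<open>full_shift N\<close>; it is the topology of the metric
  $d(x,y) = 2^{-\min\{k : x_k \ne y_k\}}$.\<close>

definition string_topology :: "nat \<Rightarrow> (nat \<Rightarrow> nat) topology" where
  "string_topology N = product_topology (\<lambda>_. discrete_topology {1..N}) UNIV"

definition contains_word :: "(nat \<Rightarrow> nat) \<Rightarrow> nat list \<Rightarrow> bool" where
  "contains_word x w \<longleftrightarrow> (\<exists>n. map x [n..<n + length w] = w)"

definition shift_space :: "nat \<Rightarrow> (nat \<Rightarrow> nat) set \<Rightarrow> bool" where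
  "shift_space N X \<longleftrightarrow>
    (\<exists>B \<subseteq> lists {1..N}. X = {x \<in> full_shift N. \<forall>w\<in>B. \<not> contains_word x w})"

text \<open>Primitivity: some positive power of the adjacency matrix has only positive entries.\<close>

definition primitive_digraph :: "('v, 'e) pre_digraph \<Rightarrow> bool" where
  "primitive_digraph G \<longleftrightarrow>
    (\<exists>k>0. \<forall>u\<in>verts G. \<forall>v\<in>verts G. \<exists>p. pre_digraph.awalk G u p v \<and> length p = k)"

text \<open>
  Graphs may have loops and parallel edges. The family \<open>f\<close> is only relevant on the
  indices \<open>{1..N}\<close>. The source $i^-$ and target $i^+$ of the edge \<open>i\<close> are \<open>tail G i\<close>
  and \<open>head G i\<close>.
\<close>

definition graph_ifs ::
    "nat \<Rightarrow> (nat \<Rightarrow> real ^ 'm \<Rightarrow> real ^ 'm) \<Rightarrow> ('v, nat) pre_digraph \<Rightarrow> bool" where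
  "graph_ifs N f G \<longleftrightarrow>
    fin_digraph G \<and> arcs G = {1..N} \<and> strongly_connected G \<and> primitive_digraph G \<and>
    (\<forall>i\<in>{1..N}. bij (f i) \<and> (\<exists>c<1. lipschitz_on c UNIV (f i)))"

definition addresses :: "('v, nat) pre_digraph \<Rightarrow> (nat \<Rightarrow> nat) set" where
  "addresses G = {\<sigma>. \<forall>k. \<sigma> k \<in> arcs G \<and> head G (\<sigma> k) = tail G (\<sigma> (Suc k))}"

definition addresses_from :: "('v, nat) pre_digraph \<Rightarrow> 'v \<Rightarrow> (nat \<Rightarrow> nat) set" where
  "addresses_from G v = {\<sigma> \<in> addresses G. tail G (\<sigma> 0) = v}"

primrec prefix_map :: "(nat \<Rightarrow> 'a \<Rightarrow> 'a) \<Rightarrow> (nat \<Rightarrow> nat) \<Rightarrow> nat \<Rightarrow> 'a \<Rightarrow> 'a" where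
  "prefix_map f \<sigma> 0 = id"
| "prefix_map f \<sigma> (Suc k) = prefix_map f \<sigma> k \<circ> f (\<sigma> k)"

definition address_map ::
    "(nat \<Rightarrow> real ^ 'm \<Rightarrow> real ^ 'm) \<Rightarrow> (nat \<Rightarrow> nat) \<Rightarrow> real ^ 'm" where
  "address_map f \<sigma> = (THE p. \<forall>x. (\<lambda>k. prefix_map f \<sigma> k x) \<longlonglongrightarrow> p)"

definition attractor ::
    "(nat \<Rightarrow> real ^ 'm \<Rightarrow> real ^ 'm) \<Rightarrow> ('v, nat) pre_digraph \<Rightarrow> (real ^ 'm) set" where
  "attractor f G = address_map f ` addresses G"

definition attractor_component ::
    "(nat \<Rightarrow> real ^ 'm \<Rightarrow> real ^ 'm) \<Rightarrow> ('v, nat) pre_digraph \<Rightarrow> 'v \<Rightarrow> (real ^ 'm) set" where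
  "attractor_component f G v = address_map f ` addresses_from G v"

definition address_fibre ::
    "(nat \<Rightarrow> real ^ 'm \<Rightarrow> real ^ 'm) \<Rightarrow> ('v, nat) pre_digraph \<Rightarrow> real ^ 'm \<Rightarrow> (nat \<Rightarrow> nat) set" where
  "address_fibre f G x = {\<sigma> \<in> addresses G. address_map f \<sigma> = x}"

text \<open>The relation \<open>less_fun\<close> is the strict lexicographic order on strings.\<close>

definition top_address ::
    "(nat \<Rightarrow> real ^ 'm \<Rightarrow> real ^ 'm) \<Rightarrow> ('v, nat) pre_digraph \<Rightarrow> real ^ 'm \<Rightarrow> nat \<Rightarrow> nat" where
  "top_address f G x =
    (THE \<sigma>. \<sigma> \<in> address_fibre f G x \<and>
       (\<forall>\<omega>\<in>address_fibre f G x. \<sigma> = \<omega> \<or> less_fun \<sigma> \<omega>))"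

definition top_addresses ::
    "(nat \<Rightarrow> real ^ 'm \<Rightarrow> real ^ 'm) \<Rightarrow> ('v, nat) pre_digraph \<Rightarrow> (nat \<Rightarrow> nat) set" where
  "top_addresses f G = top_address f G ` attractor f G"

end

theory Submission
  imports Defs
begin

text \<open>
  The set of top addresses is mapped into itself by the shift. Suppose that \<open>\<sigma>\<close> is the least
  address of \<open>x\<close>, with first letter \<open>i\<close>, and let \<open>y\<close> be the point addressed by the tail of \<open>\<sigma>\<close>.
  An address \<open>\<omega>\<close> of \<open>y\<close> starts at the same vertex as the tail of \<open>\<sigma>\<close>, because distinct components
  of the attractor are disjoint; so \<open>i\<omega>\<close> is again an address, and it addresses
  \<open>f\<^sub>i y = x\<close>. Hence an \<open>\<omega>\<close> smaller than the tail of \<open>\<sigma>\<close> would produce an address \<open>i\<omega>\<close> of \<open>x\<close>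
  smaller than \<open>\<sigma>\<close> (lemma \<open>shift_top_address\<close>).

  The closure of any shift-invariant set \<open>T\<close> of strings is a shift space: one forbids the words
  that occur in no element of \<open>T\<close>. If every block of \<open>x\<close> occurs in some element of \<open>T\<close>, then
  shifting that element moves the occurrence of a prefix of \<open>x\<close> to the front, so that elements
  of \<open>T\<close> share arbitrarily long prefixes with \<open>x\<close> (lemma \<open>shift_space_closure_of\<close>).

  The analytic input is that top addresses exist, i.e. that fibres of the address map have
  minima. Finitely many contractions have a common constant \<open>c < 1\<close>, and the images of a point
  under the compositions along an address converge at a geometric rate that does not depend on
  the address (lemma \<open>dist_prefix_map_add_le\<close>). So the limit depends continuously on the
  address, fibres are closed, and a greedy choice of letters finds their minima (lemma
  \<open>less_fun_minimum_exists\<close>).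
\<close>

section \<open>Closures of shift-invariant sets of strings\<close>

lemma closure_of_string_topology:
  assumes "T \<subseteq> full_shift N"
  shows "string_topology N closure_of T =
    {x \<in> full_shift N. \<forall>n. \<exists>y\<in>T. \<forall>k<n. y k = x k}" (is "_ = ?C")
proof -
  have top: "topspace (string_topology N) = full_shift N"
    by (auto simp: string_topology_def full_shift_def)
  show ?thesis
  proof (intro equalityI subsetI)
    fix x assume x: "x \<in> string_topology N closure_of T"
    then have xN: "x \<in> full_shift N"
      using top by (auto simp: in_closure_of)
    have "\<exists>y\<in>T. \<forall>k<n. y k = x k" for n
    proof -
      define W where "W = (\<lambda>k. if k < n then {x k} else {1..N})"
      have "{k. W k \<noteq> {1..N}} \<subseteq> {..<n}"
        by (auto simp: W_def)
      then have "finite {k. W k \<noteq> {1..N}}"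
        by (rule finite_subset) simp
      moreover have "W k \<subseteq> {1..N}" for k
        using xN by (auto simp: W_def full_shift_def)
      ultimately have "openin (string_topology N) (Pi\<^sub>E UNIV W)"
        unfolding string_topology_def by (intro product_topology_basis) auto
      moreover have "x \<in> Pi\<^sub>E UNIV W"
        using xN by (auto simp: W_def full_shift_def)
      ultimately obtain y where "y \<in> T" "y \<in> Pi\<^sub>E UNIV W"
        using x by (auto simp: in_closure_of)
      moreover have "y k = x k" if "k < n" for k
        using PiE_mem[OF \<open>y \<in> Pi\<^sub>E UNIV W\<close>, of k] that by (simp add: W_def)
      ultimately show ?thesis by blast
    qed
    with xN show "x \<in> ?C" by blast
  next
    fix x assume x: "x \<in> ?C"
    have "\<exists>y. y \<in> T \<and> y \<in> U" if xU: "x \<in> U" and U: "openin (string_topology N) U" for U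
    proof -
      have "\<forall>x\<in>U. \<exists>W. finite {k. W k \<noteq> {1..N}} \<and> (\<forall>k. W k \<subseteq> {1..N}) \<and>
          x \<in> Pi\<^sub>E UNIV W \<and> Pi\<^sub>E UNIV W \<subseteq> U"
        using U by (simp add: string_topology_def openin_product_topology_alt)
      from bspec[OF this xU] obtain W where
        "finite {k. W k \<noteq> {1..N}} \<and> (\<forall>k. W k \<subseteq> {1..N}) \<and>
          x \<in> Pi\<^sub>E UNIV W \<and> Pi\<^sub>E UNIV W \<subseteq> U" ..
      then have fin: "finite {k. W k \<noteq> {1..N}}" and xW: "x \<in> Pi\<^sub>E UNIV W"
          and WU: "Pi\<^sub>E UNIV W \<subseteq> U"
        by simp_all
      obtain n where n: "\<And>k. W k \<noteq> {1..N} \<Longrightarrow> k < n"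
        using finite_nat_bounded[OF fin] by blast
      obtain y where y: "y \<in> T" "\<And>k. k < n \<Longrightarrow> y k = x k"
        using x by blast
      have "y k \<in> W k" for k
      proof (cases "k < n")
        case True
        then show ?thesis using y(2) PiE_mem[OF xW, of k] by simp
      next
        case False
        then have "W k = {1..N}" using n by blast
        moreover have "y k \<in> {1..N}" using y(1) assms by (auto simp: full_shift_def)
        ultimately show ?thesis by simp
      qed
      then show ?thesis using y(1) WU by blast
    qed
    then show "x \<in> string_topology N closure_of T"
      using x top by (auto simp: in_closure_of)
  qed
qed

lemma shift_iterate_mem:
  assumes "\<And>x. x \<in> T \<Longrightarrow> (\<lambda>k. x (Suc k)) \<in> T" and "x \<in> T"
  shows "(\<lambda>k. x (n + k)) \<in> T"
proof (induction n)
  case 0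
  then show ?case using assms(2) by simp
next
  case (Suc n)
  from assms(1)[OF Suc] show ?case by simp
qed

text \<open>The forbidden words are those that occur in no element of the given set. An occurrence
  inside an element can be shifted to the front, where it describes a neighbourhood.\<close>

lemma shift_space_closure_of:
  assumes sub: "T \<subseteq> full_shift N"
    and shift: "\<And>x. x \<in> T \<Longrightarrow> (\<lambda>k. x (Suc k)) \<in> T"
  shows "shift_space N (string_topology N closure_of T)"
proof -
  define B where "B = {w \<in> lists {1..N}. \<forall>y\<in>T. \<not> contains_word y w}"
  have "(\<forall>n. \<exists>y\<in>T. \<forall>k<n. y k = x k) \<longleftrightarrow> (\<forall>w\<in>B. \<not> contains_word x w)"
    if x: "x \<in> full_shift N" for x
  proof (intro iffI allI ballI notI)
    fix w assume approx: "\<forall>n. \<exists>y\<in>T. \<forall>k<n. y k = x k" and "w \<in> B" and "contains_word x w"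
    then obtain n where n: "map x [n..<n + length w] = w"
      by (auto simp: contains_word_def)
    obtain y where y: "y \<in> T" "\<And>k. k < n + length w \<Longrightarrow> y k = x k"
      using approx by blast
    have "map y [n..<n + length w] = map x [n..<n + length w]"
      using y(2) by simp
    with n have "contains_word y w"
      unfolding contains_word_def by metis
    with y(1) \<open>w \<in> B\<close> show False by (simp add: B_def)
  next
    fix n assume avoid: "\<forall>w\<in>B. \<not> contains_word x w"
    let ?w = "map x [0..<n]"
    have "contains_word x ?w"
      unfolding contains_word_def by (intro exI[of _ 0]) simp
    moreover have "?w \<in> lists {1..N}"
      using x by (auto simp: full_shift_def)
    ultimately obtain y where "y \<in> T" "contains_word y ?w"
      using avoid by (auto simp: B_def)
    then obtain m where m: "map y [m..<m + n] = ?w"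
      by (auto simp: contains_word_def)
    have "y (m + k) = x k" if "k < n" for k
      using arg_cong[OF m, of "\<lambda>w. w ! k"] that by simp
    moreover have "(\<lambda>k. y (m + k)) \<in> T"
      using shift \<open>y \<in> T\<close> by (rule shift_iterate_mem)
    ultimately show "\<exists>y\<in>T. \<forall>k<n. y k = x k"
      by (intro bexI[of _ "\<lambda>k. y (m + k)"]) auto
  qed
  then have "string_topology N closure_of T = {x \<in> full_shift N. \<forall>w\<in>B. \<not> contains_word x w}"
    using closure_of_string_topology[OF sub] by auto
  moreover have "B \<subseteq> lists {1..N}" by (auto simp: B_def)
  ultimately show ?thesis unfolding shift_space_def by blast
qed

section \<open>Lexicographic minima\<close>

text \<open>Greedy construction of a minimum of \<open>F\<close>: the next letter is the least one that still
  continues to an element of \<open>F\<close>. The hypothesis \<open>closed\<close> says that \<open>F\<close> is closed in the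
  product topology, which puts the resulting string into \<open>F\<close>.\<close>

lemma less_fun_minimum_exists:
  fixes F :: "(nat \<Rightarrow> nat) set"
  assumes "F \<noteq> {}"
    and closed: "\<And>\<sigma>. (\<And>n. \<exists>\<omega>\<in>F. \<forall>k<n. \<omega> k = \<sigma> k) \<Longrightarrow> \<sigma> \<in> F"
  obtains \<sigma> where "\<sigma> \<in> F" and "\<And>\<omega>. \<omega> \<in> F \<Longrightarrow> \<sigma> = \<omega> \<or> less_fun \<sigma> \<omega>"
proof -
  define letter where "letter w = (LEAST l. \<exists>\<omega>\<in>F. map \<omega> [0..<length w] = w \<and> \<omega> (length w) = l)"
    for w
  define word where "word = rec_nat [] (\<lambda>_ w. w @ [letter w])"
  define \<sigma> where "\<sigma> n = letter (word n)" for n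
  have word: "word n = map \<sigma> [0..<n]" for n
    by (induction n) (auto simp: word_def \<sigma>_def)
  have \<sigma>: "\<sigma> n = (LEAST l. \<exists>\<omega>\<in>F. (\<forall>k<n. \<omega> k = \<sigma> k) \<and> \<omega> n = l)" for n
  proof -
    have "map \<omega> [0..<n] = map \<sigma> [0..<n] \<longleftrightarrow> (\<forall>k<n. \<omega> k = \<sigma> k)" for \<omega>
      by auto
    then show ?thesis
      by (subst \<sigma>_def) (simp add: letter_def word)
  qed
  have approx: "\<exists>\<omega>\<in>F. \<forall>k<n. \<omega> k = \<sigma> k" for n
  proof (induction n)
    case 0
    then show ?case using \<open>F \<noteq> {}\<close> by auto
  next
    case (Suc n)
    then have "\<exists>l. \<exists>\<omega>\<in>F. (\<forall>k<n. \<omega> k = \<sigma> k) \<and> \<omega> n = l" by blast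
    from LeastI_ex[OF this] have "\<exists>\<omega>\<in>F. (\<forall>k<n. \<omega> k = \<sigma> k) \<and> \<omega> n = \<sigma> n"
      by (simp flip: \<sigma>)
    then show ?case by (auto simp: less_Suc_eq)
  qed
  have "\<sigma> = \<omega> \<or> less_fun \<sigma> \<omega>" if "\<omega> \<in> F" for \<omega>
  proof (rule disjCI)
    assume "\<not> less_fun \<sigma> \<omega>"
    have "\<omega> k = \<sigma> k" for k
    proof (induction k rule: less_induct)
      case (less k)
      have "\<sigma> k \<le> \<omega> k"
        by (subst \<sigma>, rule Least_le) (use less \<open>\<omega> \<in> F\<close> in blast)
      moreover have "\<not> \<sigma> k < \<omega> k"
        using \<open>\<not> less_fun \<sigma> \<omega>\<close> less by (auto simp: less_fun_def)
      ultimately show ?case by simp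
    qed
    then show "\<sigma> = \<omega>" by auto
  qed
  with closed[OF approx] show ?thesis by (rule that)
qed

section \<open>The address map of a uniformly contractive family\<close>

lemma prefix_map_add:
  "prefix_map f \<sigma> (k + n) = prefix_map f \<sigma> k \<circ> prefix_map f (\<lambda>j. \<sigma> (k + j)) n"
  by (induction n) (simp_all add: o_assoc)

lemma prefix_map_Suc_tail:
  "prefix_map f \<sigma> (Suc k) = f (\<sigma> 0) \<circ> prefix_map f (\<lambda>j. \<sigma> (Suc j)) k"
  using prefix_map_add[of f \<sigma> 1 k] by simp

lemma prefix_map_cong:
  "(\<And>j. j < k \<Longrightarrow> \<sigma> j = \<omega> j) \<Longrightarrow> prefix_map f \<sigma> k = prefix_map f \<omega> k"
  by (induction k) auto

lemma address_map_eqI: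
  assumes "\<And>x. (\<lambda>k. prefix_map f \<sigma> k x) \<longlonglongrightarrow> p"
  shows "address_map f \<sigma> = p"
  unfolding address_map_def
  by (rule the_equality) (use assms LIMSEQ_unique in blast)+

lemma finite_uniform_lipschitz_constant:
  assumes "finite I" and "\<And>i. i \<in> I \<Longrightarrow> \<exists>c<1. c-lipschitz_on UNIV (f i)"
  obtains c where "0 \<le> c" "c < 1" "\<And>i. i \<in> I \<Longrightarrow> c-lipschitz_on UNIV (f i)"
proof -
  obtain C where C: "\<And>i. i \<in> I \<Longrightarrow> C i < 1 \<and> (C i)-lipschitz_on UNIV (f i)"
    using assms(2) by metis
  let ?c = "Max (insert 0 (C ` I))"
  show ?thesis
  proof (rule that[of ?c])
    show "0 \<le> ?c" using assms(1) by (intro Max_ge) auto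
    show "?c < 1" using assms(1) C by (subst Max_less_iff) auto
    fix i assume "i \<in> I"
    then have "C i \<le> ?c" using assms(1) by (intro Max_ge) auto
    with C \<open>i \<in> I\<close> show "?c-lipschitz_on UNIV (f i)"
      by (meson lipschitz_on_le)
  qed
qed

context
  fixes N :: nat and f :: "nat \<Rightarrow> real ^ 'm \<Rightarrow> real ^ 'm" and c :: real
  assumes c: "0 \<le> c" "c < 1"
    and lip: "\<And>i. i \<in> {1..N} \<Longrightarrow> c-lipschitz_on UNIV (f i)"
begin

lemma dist_prefix_map_le:
  assumes "\<sigma> \<in> full_shift N"
  shows "dist (prefix_map f \<sigma> k x) (prefix_map f \<sigma> k y) \<le> c ^ k * dist x y"
proof (induction k arbitrary: x y)
  case 0
  then show ?case by simp
next
  case (Suc k)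
  have "dist (prefix_map f \<sigma> (Suc k) x) (prefix_map f \<sigma> (Suc k) y)
      \<le> c ^ k * dist (f (\<sigma> k) x) (f (\<sigma> k) y)"
    using Suc by simp
  also have "\<dots> \<le> c ^ k * (c * dist x y)"
    using assms c by (intro mult_left_mono lipschitz_onD[OF lip]) (auto simp: full_shift_def)
  finally show ?case by (simp add: mult_ac)
qed

text \<open>If every \<open>f\<^sub>i\<close> moves \<open>a\<close> by at most \<open>D\<close>, the ball of radius \<open>D / (1 - c)\<close> about \<open>a\<close> traps
  all images of \<open>a\<close>, since \<open>c * (D / (1 - c)) + D = D / (1 - c)\<close>.\<close>

lemma prefix_map_orbit_bounded:
  obtains K where "\<And>\<sigma> n. \<sigma> \<in> full_shift N \<Longrightarrow> dist (prefix_map f \<sigma> n a) a \<le> K"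
proof -
  define D where "D = Max (insert 0 ((\<lambda>i. dist (f i a) a) ` {1..N}))"
  define K where "K = D / (1 - c)"
  have D0: "0 \<le> D" unfolding D_def by (intro Max_ge) auto
  have D: "dist (f i a) a \<le> D" if "i \<in> {1..N}" for i
    unfolding D_def using that by (intro Max_ge) auto
  have K0: "0 \<le> K" using D0 c by (simp add: K_def)
  have K: "c * K + D = K" using c by (simp add: K_def field_simps)
  have "dist (prefix_map f \<sigma> n a) a \<le> K" if "\<sigma> \<in> full_shift N" for \<sigma> n
    using that
  proof (induction n arbitrary: \<sigma>)
    case 0
    then show ?case using K0 by simp
  next
    case (Suc n)
    let ?z = "prefix_map f (\<lambda>j. \<sigma> (Suc j)) n a"
    have \<sigma>0: "\<sigma> 0 \<in> {1..N}" using Suc.prems by (auto simp: full_shift_def)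
    have "prefix_map f \<sigma> (Suc n) a = f (\<sigma> 0) ?z"
      by (simp only: prefix_map_Suc_tail o_apply)
    then have "dist (prefix_map f \<sigma> (Suc n) a) a
        \<le> dist (f (\<sigma> 0) ?z) (f (\<sigma> 0) a) + dist (f (\<sigma> 0) a) a"
      by (metis dist_triangle)
    also have "\<dots> \<le> c * dist ?z a + D"
      using lipschitz_onD[OF lip[OF \<sigma>0], of ?z a] D[OF \<sigma>0] by simp
    also have "\<dots> \<le> c * K + D"
      using Suc c by (intro add_right_mono mult_left_mono Suc.IH) (auto simp: full_shift_def)
    finally show ?case using K by simp
  qed
  then show ?thesis by (rule that)
qed

text \<open>The composition along the first \<open>k + n\<close> letters factors through the one along the next
  \<open>n\<close> letters, whose value at \<open>0\<close> stays in a fixed ball; the first \<open>k\<close> maps shrink that ball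
  by \<open>c ^ k\<close>.\<close>

lemma dist_prefix_map_add_le:
  obtains K where "\<And>\<sigma> k n. \<sigma> \<in> full_shift N \<Longrightarrow>
    dist (prefix_map f \<sigma> (k + n) 0) (prefix_map f \<sigma> k 0) \<le> c ^ k * K"
proof -
  obtain K where K: "\<And>\<sigma> n. \<sigma> \<in> full_shift N \<Longrightarrow> dist (prefix_map f \<sigma> n 0) 0 \<le> K"
    by (rule prefix_map_orbit_bounded[of 0]) blast
  have "dist (prefix_map f \<sigma> (k + n) 0) (prefix_map f \<sigma> k 0) \<le> c ^ k * K"
    if \<sigma>: "\<sigma> \<in> full_shift N" for \<sigma> k n
  proof -
    have tail: "(\<lambda>j. \<sigma> (k + j)) \<in> full_shift N" using \<sigma> by (simp add: full_shift_def)
    have "dist (prefix_map f \<sigma> (k + n) 0) (prefix_map f \<sigma> k 0)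
        \<le> c ^ k * dist (prefix_map f (\<lambda>j. \<sigma> (k + j)) n 0) 0"
      unfolding prefix_map_add o_apply by (rule dist_prefix_map_le[OF \<sigma>])
    also have "\<dots> \<le> c ^ k * K"
      using K[OF tail, of n] c by (intro mult_left_mono) simp_all
    finally show ?thesis .
  qed
  then show ?thesis by (rule that)
qed

lemma prefix_map_tendsto_address_map:
  assumes \<sigma>: "\<sigma> \<in> full_shift N"
  shows "(\<lambda>k. prefix_map f \<sigma> k x) \<longlonglongrightarrow> address_map f \<sigma>"
proof -
  have c_pow: "(\<lambda>k. c ^ k * r) \<longlonglongrightarrow> 0" for r
    using c by (intro tendsto_mult_left_zero LIMSEQ_power_zero) simp
  obtain K where K: "\<And>\<sigma> k n. \<sigma> \<in> full_shift N \<Longrightarrow>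
      dist (prefix_map f \<sigma> (k + n) 0) (prefix_map f \<sigma> k 0) \<le> c ^ k * K"
    by (rule dist_prefix_map_add_le) blast
  have "Cauchy (\<lambda>k. prefix_map f \<sigma> k 0)"
  proof (rule metric_CauchyI)
    fix e :: real assume "0 < e"
    then obtain k where "c ^ k * K < e / 2"
      using order_tendstoD(2)[OF c_pow[of K], of "e / 2"] by (auto simp: eventually_sequentially)
    then have near: "dist (prefix_map f \<sigma> k 0) (prefix_map f \<sigma> m 0) < e / 2" if "m \<ge> k" for m
      using K[OF \<sigma>, of k "m - k"] that by (simp add: dist_commute)
    show "\<exists>M. \<forall>m\<ge>M. \<forall>n\<ge>M. dist (prefix_map f \<sigma> m 0) (prefix_map f \<sigma> n 0) < e"
      using near dist_triangle_half_r by blast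
  qed
  then obtain p where p: "(\<lambda>k. prefix_map f \<sigma> k 0) \<longlonglongrightarrow> p"
    using Cauchy_convergent convergent_def by blast
  have lim: "(\<lambda>k. prefix_map f \<sigma> k y) \<longlonglongrightarrow> p" for y
  proof (rule Lim_transform2[OF p])
    show "(\<lambda>k. prefix_map f \<sigma> k 0 - prefix_map f \<sigma> k y) \<longlonglongrightarrow> 0"
    proof (rule Lim_null_comparison[OF _ c_pow[of "dist 0 y"]])
      show "\<forall>\<^sub>F k in sequentially.
          norm (prefix_map f \<sigma> k 0 - prefix_map f \<sigma> k y) \<le> c ^ k * dist 0 y"
        unfolding dist_norm[symmetric]
        by (intro always_eventually allI dist_prefix_map_le[OF \<sigma>])
    qed
  qed
  with address_map_eqI[OF lim] show ?thesis by simp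
qed

lemma address_map_case_nat:
  assumes "i \<in> {1..N}" and "\<omega> \<in> full_shift N"
  shows "address_map f (case_nat i \<omega>) = f i (address_map f \<omega>)"
proof (rule LIMSEQ_unique)
  have "case_nat i \<omega> \<in> full_shift N"
    using assms by (auto simp: full_shift_def split: nat.split)
  from LIMSEQ_Suc[OF prefix_map_tendsto_address_map[OF this, of 0]]
  show "(\<lambda>k. f i (prefix_map f \<omega> k 0)) \<longlonglongrightarrow> address_map f (case_nat i \<omega>)"
    by (simp only: prefix_map_Suc_tail o_apply nat.case)
  have "isCont (f i) (address_map f \<omega>)"
    using lipschitz_on_continuous_on[OF lip[OF assms(1)]]
    by (simp add: continuous_on_eq_continuous_at)
  then show "(\<lambda>k. f i (prefix_map f \<omega> k 0)) \<longlonglongrightarrow> f i (address_map f \<omega>)"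
    using prefix_map_tendsto_address_map[OF assms(2)] by (rule isCont_tendsto_compose)
qed

text \<open>A modulus of continuity for the address map: strings that share their first \<open>k\<close> letters
  have the same \<open>prefix_map f \<sigma> k\<close>, so their images are at distance at most \<open>2 * c ^ k * K\<close>.\<close>

lemma dist_address_map_prefix_map:
  obtains K where "\<And>\<sigma> k. \<sigma> \<in> full_shift N \<Longrightarrow>
    dist (address_map f \<sigma>) (prefix_map f \<sigma> k 0) \<le> c ^ k * K"
proof -
  obtain K where K: "\<And>\<sigma> k n. \<sigma> \<in> full_shift N \<Longrightarrow>
      dist (prefix_map f \<sigma> (k + n) 0) (prefix_map f \<sigma> k 0) \<le> c ^ k * K"
    by (rule dist_prefix_map_add_le) blast
  have "dist (address_map f \<sigma>) (prefix_map f \<sigma> k 0) \<le> c ^ k * K" if \<sigma>: "\<sigma> \<in> full_shift N" for \<sigma> k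
  proof -
    have "dist (prefix_map f \<sigma> (n + k) 0) (prefix_map f \<sigma> k 0) \<le> c ^ k * K" for n
      using K[OF \<sigma>, of k n] by (simp add: add.commute)
    moreover have "(\<lambda>n. dist (prefix_map f \<sigma> (n + k) 0) (prefix_map f \<sigma> k 0))
        \<longlonglongrightarrow> dist (address_map f \<sigma>) (prefix_map f \<sigma> k 0)"
      by (intro tendsto_dist tendsto_const LIMSEQ_ignore_initial_segment
          prefix_map_tendsto_address_map \<sigma>)
    ultimately show ?thesis by (intro LIMSEQ_le_const2) auto
  qed
  then show ?thesis by (rule that)
qed

text \<open>Fibres of the address map are closed.\<close>

lemma address_map_eq_if_approximated:
  assumes \<sigma>: "\<sigma> \<in> full_shift N"
    and approx: "\<And>n. \<exists>\<omega>\<in>full_shift N. address_map f \<omega> = x \<and> (\<forall>k<n. \<omega> k = \<sigma> k)"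
  shows "address_map f \<sigma> = x"
proof -
  obtain K where K: "\<And>\<sigma> k. \<sigma> \<in> full_shift N \<Longrightarrow>
      dist (address_map f \<sigma>) (prefix_map f \<sigma> k 0) \<le> c ^ k * K"
    by (rule dist_address_map_prefix_map) blast
  have near: "dist (prefix_map f \<sigma> n 0) x \<le> c ^ n * K" for n
  proof -
    obtain \<omega> where \<omega>: "\<omega> \<in> full_shift N" "address_map f \<omega> = x" "\<And>k. k < n \<Longrightarrow> \<omega> k = \<sigma> k"
      using approx by metis
    have "prefix_map f \<omega> n = prefix_map f \<sigma> n"
      by (rule prefix_map_cong) (use \<omega>(3) in auto)
    then show ?thesis using K[OF \<omega>(1), of n] \<omega>(2) by (simp add: dist_commute)
  qed
  have rate: "(\<lambda>n. c ^ n * K) \<longlonglongrightarrow> 0"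
    using c by (intro tendsto_mult_left_zero LIMSEQ_power_zero) simp
  have "(\<lambda>n. dist (prefix_map f \<sigma> n 0) x) \<longlonglongrightarrow> 0"
    by (rule tendsto_sandwich[OF _ _ tendsto_const rate])
      (auto intro!: always_eventually near)
  then have "(\<lambda>n. prefix_map f \<sigma> n 0) \<longlonglongrightarrow> x"
    by (rule tendsto_dist_iff[THEN iffD2])
  with prefix_map_tendsto_address_map[OF \<sigma>] show ?thesis by (rule LIMSEQ_unique)
qed

end

section \<open>Top addresses\<close>

lemma graph_ifs_uniform_contraction:
  assumes "graph_ifs N f G"
  obtains c where "0 \<le> c" "c < 1" "\<And>i. i \<in> {1..N} \<Longrightarrow> c-lipschitz_on UNIV (f i)"
  by (rule finite_uniform_lipschitz_constant[of "{1..N}" f])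
    (use assms in \<open>auto simp: graph_ifs_def\<close>)

lemma addresses_subset_full_shift:
  assumes "graph_ifs N f G"
  shows "addresses G \<subseteq> full_shift N"
  using assms by (auto simp: graph_ifs_def addresses_def full_shift_def)

lemma top_address_properties:
  fixes f :: "nat \<Rightarrow> real ^ 'm \<Rightarrow> real ^ 'm"
  assumes ifs: "graph_ifs N f G" and x: "x \<in> attractor f G"
  shows "top_address f G x \<in> address_fibre f G x"
    and "\<omega> \<in> address_fibre f G x \<Longrightarrow> top_address f G x = \<omega> \<or> less_fun (top_address f G x) \<omega>"
proof -
  obtain c where c: "0 \<le> c" "c < 1" "\<And>i. i \<in> {1..N} \<Longrightarrow> c-lipschitz_on UNIV (f i)"
    by (rule graph_ifs_uniform_contraction[OF ifs]) blast
  note full = addresses_subset_full_shift[OF ifs]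
  let ?F = "address_fibre f G x"
  have closed: "\<sigma> \<in> ?F" if approx: "\<And>n. \<exists>\<omega>\<in>?F. \<forall>k<n. \<omega> k = \<sigma> k" for \<sigma>
  proof -
    have \<sigma>: "\<sigma> \<in> addresses G"
      unfolding addresses_def
    proof (rule CollectI, rule allI)
      fix k
      \<comment> \<open>Being an address is a condition on pairs of consecutive letters.\<close>
      obtain \<omega> where "\<omega> \<in> addresses G" "\<And>j. j < Suc (Suc k) \<Longrightarrow> \<omega> j = \<sigma> j"
        using approx[of "Suc (Suc k)"] by (auto simp: address_fibre_def)
      then have "\<omega> k = \<sigma> k" "\<omega> (Suc k) = \<sigma> (Suc k)" "\<omega> \<in> addresses G" by auto
      then show "\<sigma> k \<in> arcs G \<and> head G (\<sigma> k) = tail G (\<sigma> (Suc k))"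
        unfolding addresses_def by (metis (mono_tags, lifting) mem_Collect_eq)
    qed
    have "address_map f \<sigma> = x"
    proof (rule address_map_eq_if_approximated[OF c(1,2)])
      show "c-lipschitz_on UNIV (f i)" if "i \<in> {1..N}" for i
        using that by (rule c(3))
      show "\<sigma> \<in> full_shift N" using \<sigma> full by blast
      show "\<exists>\<omega>\<in>full_shift N. address_map f \<omega> = x \<and> (\<forall>k<n. \<omega> k = \<sigma> k)" for n
        using approx[of n] full by (auto simp: address_fibre_def)
    qed
    with \<sigma> show ?thesis by (simp add: address_fibre_def)
  qed
  have "?F \<noteq> {}"
    using x by (auto simp: attractor_def address_fibre_def)
  then obtain \<sigma> where \<sigma>: "\<sigma> \<in> ?F" "\<And>\<omega>. \<omega> \<in> ?F \<Longrightarrow> \<sigma> = \<omega> \<or> less_fun \<sigma> \<omega>"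
    using less_fun_minimum_exists[of ?F] closed by metis
  have "\<exists>!\<sigma>. \<sigma> \<in> ?F \<and> (\<forall>\<omega>\<in>?F. \<sigma> = \<omega> \<or> less_fun \<sigma> \<omega>)"
  proof (rule ex1I[of _ \<sigma>])
    show "\<sigma>' = \<sigma>" if "\<sigma>' \<in> ?F \<and> (\<forall>\<omega>\<in>?F. \<sigma>' = \<omega> \<or> less_fun \<sigma>' \<omega>)" for \<sigma>'
      using that \<sigma> less_fun_asym by blast
  qed (use \<sigma> in blast)
  from theI'[OF this, folded top_address_def]
  show "top_address f G x \<in> ?F"
    and "\<omega> \<in> ?F \<Longrightarrow> top_address f G x = \<omega> \<or> less_fun (top_address f G x) \<omega>"
    by blast+
qed

lemma less_fun_case_nat:
  fixes \<omega> \<sigma> :: "nat \<Rightarrow> nat"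
  assumes "less_fun \<omega> (\<lambda>k. \<sigma> (Suc k))"
  shows "less_fun (case_nat (\<sigma> 0) \<omega>) \<sigma>"
proof -
  obtain k where k: "\<omega> k < \<sigma> (Suc k)" "\<And>j. j < k \<Longrightarrow> \<omega> j = \<sigma> (Suc j)"
    using assms by (auto simp: less_fun_def)
  show ?thesis
    unfolding less_fun_def
    by (rule exI[of _ "Suc k"]) (use k in \<open>auto split: nat.split\<close>)
qed

text \<open>Disjointness of the components allows the first letter of a top address to be put in front
  of every other address of the point that its tail addresses. A smaller tail would therefore
  give a smaller address of the original point.\<close>

lemma shift_top_address:
  fixes f :: "nat \<Rightarrow> real ^ 'm \<Rightarrow> real ^ 'm"
  assumes ifs: "graph_ifs N f G"
    and disj: "\<And>v v'. v \<in> verts G \<Longrightarrow> v' \<in> verts G \<Longrightarrow> v \<noteq> v' \<Longrightarrow>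
      attractor_component f G v \<inter> attractor_component f G v' = {}"
    and top: "\<sigma> \<in> top_addresses f G"
  shows "(\<lambda>k. \<sigma> (Suc k)) \<in> top_addresses f G"
proof -
  obtain c where c: "0 \<le> c" "c < 1" "\<And>i. i \<in> {1..N} \<Longrightarrow> c-lipschitz_on UNIV (f i)"
    by (rule graph_ifs_uniform_contraction[OF ifs]) blast
  note full = addresses_subset_full_shift[OF ifs]
  interpret fin_digraph G using ifs by (simp add: graph_ifs_def)
  obtain x where x: "x \<in> attractor f G" and \<sigma>_def: "\<sigma> = top_address f G x"
    using top by (auto simp: top_addresses_def)
  note \<sigma> = top_address_properties[OF ifs x, folded \<sigma>_def]
  have \<sigma>_addr: "\<sigma> \<in> addresses G" and \<sigma>_x: "address_map f \<sigma> = x"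
    using \<sigma>(1) by (auto simp: address_fibre_def)
  have \<sigma>0: "\<sigma> 0 \<in> {1..N}"
    using \<sigma>_addr full by (auto simp: full_shift_def)
  have cons: "address_map f (case_nat (\<sigma> 0) \<omega>) = f (\<sigma> 0) (address_map f \<omega>)"
    if "\<omega> \<in> addresses G" for \<omega>
    by (rule address_map_case_nat[OF c(1,2) _ \<sigma>0]) (use c(3) that full in auto)
  define \<rho> where "\<rho> = (\<lambda>k. \<sigma> (Suc k))"
  have \<rho>_addr: "\<rho> \<in> addresses G"
    using \<sigma>_addr by (auto simp: addresses_def \<rho>_def)
  define y where "y = address_map f \<rho>"
  have "case_nat (\<sigma> 0) \<rho> = \<sigma>"
    by (auto simp: \<rho>_def fun_eq_iff split: nat.split)
  then have fy: "f (\<sigma> 0) y = x"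
    using cons[OF \<rho>_addr] \<sigma>_x by (simp add: y_def)
  have y: "y \<in> attractor f G"
    using \<rho>_addr by (auto simp: attractor_def y_def)
  define \<omega> where "\<omega> = top_address f G y"
  note \<omega> = top_address_properties[OF ifs y, folded \<omega>_def]
  have \<omega>_addr: "\<omega> \<in> addresses G" and \<omega>_y: "address_map f \<omega> = y"
    using \<omega>(1) by (auto simp: address_fibre_def)
  have same_source: "tail G (\<omega> 0) = tail G (\<rho> 0)"
  proof (rule ccontr)
    assume "tail G (\<omega> 0) \<noteq> tail G (\<rho> 0)"
    moreover have "tail G (\<omega> 0) \<in> verts G" "tail G (\<rho> 0) \<in> verts G"
      using \<omega>_addr \<rho>_addr by (auto simp: addresses_def)
    ultimately have "attractor_component f G (tail G (\<omega> 0))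
        \<inter> attractor_component f G (tail G (\<rho> 0)) = {}"
      by (intro disj)
    moreover have "y \<in> attractor_component f G (tail G (\<omega> 0))"
      using \<omega>_addr \<omega>_y by (auto simp: attractor_component_def addresses_from_def)
    moreover have "y \<in> attractor_component f G (tail G (\<rho> 0))"
      using \<rho>_addr by (auto simp: attractor_component_def addresses_from_def y_def)
    ultimately show False by blast
  qed
  have "\<omega> = \<rho>"
  proof (rule ccontr)
    assume "\<omega> \<noteq> \<rho>"
    moreover have "\<rho> \<in> address_fibre f G y"
      using \<rho>_addr by (simp add: address_fibre_def y_def)
    ultimately have "less_fun \<omega> \<rho>" using \<omega>(2) by blast
    then have smaller: "less_fun (case_nat (\<sigma> 0) \<omega>) \<sigma>"
      unfolding \<rho>_def by (rule less_fun_case_nat)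
    have "case_nat (\<sigma> 0) \<omega> \<in> addresses G"
      using \<omega>_addr \<sigma>_addr same_source
      by (auto simp: addresses_def \<rho>_def split: nat.split)
    moreover have "address_map f (case_nat (\<sigma> 0) \<omega>) = x"
      using cons[OF \<omega>_addr] \<omega>_y fy by simp
    ultimately have "case_nat (\<sigma> 0) \<omega> \<in> address_fibre f G x"
      by (simp add: address_fibre_def)
    with \<sigma>(2) smaller show False
      using less_fun_asym less_fun_irrefl by metis
  qed
  then show ?thesis
    using imageI[OF y, of "top_address f G"] by (simp add: top_addresses_def \<omega>_def \<rho>_def)
qed

theorem theorem4p3:
  fixes N :: nat
    and f :: "nat \<Rightarrow> real ^ 'm \<Rightarrow> real ^ 'm"
    and G :: "('v, nat) pre_digraph"
  assumes "graph_ifs N f G"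
    and "\<And>v v'. v \<in> verts G \<Longrightarrow> v' \<in> verts G \<Longrightarrow> v \<noteq> v' \<Longrightarrow>
           attractor_component f G v \<inter> attractor_component f G v' = {}"
  shows "shift_space N (string_topology N closure_of top_addresses f G)"
proof (rule shift_space_closure_of)
  show "top_addresses f G \<subseteq> full_shift N"
    using top_address_properties(1)[OF assms(1)] addresses_subset_full_shift[OF assms(1)]
    by (fastforce simp: top_addresses_def address_fibre_def)
  show "(\<lambda>k. \<sigma> (Suc k)) \<in> top_addresses f G" if "\<sigma> \<in> top_addresses f G" for \<sigma>
    using assms that by (rule shift_top_address)
qed

end
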